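(* Let $a\ge2$ be an integer, $H=\langle a,a+1\rangle$, $k$ a field, $A=k[[H]]=k[[t^a,t^{a+1}]]\subseteq k[[t]]$, and $\mathfrak m=(t^a,t^{a+1})$ the maximal ideal of $A$. Let $q=a-1$, let $s\in H$ with $0<s<aq$, and put $Q=(t^s)$ and $I=Q:\mathfrak m^q$. Write $s=a\ell+r$ with integers $1\le\ell<q$ and $0\le r<a$, assume that $0<r<\ell$, and let $\kappa=\ell-r$. If $2\ell+1\ge a\ge\ell+\kappa+2$, then $Q\cap I^3\ne QI^2$, whence $\mathrm G(I)$ is not a Cohen-Macaulay ring.
   Context: $\langle a,a+1\rangle=\{\alpha a+\beta(a+1)\mid 0\le\alpha,\beta\in\mathbb Z\}$. $k[[t]]$ is the formal power series ring in an indeterminate $t$; $Q:\mathfrak m^q=\{x\in A\mid\mathfrak m^qx\subseteq Q\}$. $\mathrm G(I)=\bigoplus_{n\ge0}I^n/I^{n+1}$ is the associated graded ring. *)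

theory Defs
  imports
    "HOL-Algebra.Algebra"
    "HOL-Algebra.Algebraic_Closure_Type"
    "HOL-Computational_Algebra.Formal_Power_Series"
    "HOL-Library.Extended_Nat"
begin

section \<open>Semigroup rings in one variable\<close>

definition consecutive_semigroup :: "nat \<Rightarrow> nat set" where
  "consecutive_semigroup a = {\<alpha> * a + \<beta> * (a + 1) | \<alpha> \<beta>. True}"

text \<open>For a submonoid \<open>H\<close> of the natural numbers, \<open>k[[H]]\<close> consists of the power series whose
  support lies in \<open>H\<close>, with the operations of \<open>k[[t]]\<close>.\<close>

definition semigroup_ring :: "nat set \<Rightarrow> 'k::field fps ring" where
  "semigroup_ring H =
     (ring_of_type_algebra :: 'k fps ring)
       \<lparr>carrier := {f. \<forall>n. fps_nth f n \<noteq> 0 \<longrightarrow> n \<in> H}\<rparr>"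


section \<open>Ideal quotients and powers\<close>

definition colon_ideal :: "('a, 'b) ring_scheme \<Rightarrow> 'a set \<Rightarrow> 'a set \<Rightarrow> 'a set" where
  "colon_ideal R J K = {x \<in> carrier R. \<forall>y\<in>K. y \<otimes>\<^bsub>R\<^esub> x \<in> J}"

text \<open>The unit of the multiplicative monoid of ideals is the unit ideal, so the zeroth power of
  every ideal is the whole ring.\<close>

abbreviation ideal_power :: "('a, 'b) ring_scheme \<Rightarrow> 'a set \<Rightarrow> nat \<Rightarrow> 'a set" where
  "ideal_power R I n \<equiv> I [^]\<^bsub>ideals_set R\<^esub> n"


section \<open>The associated graded ring of an ideal\<close>

text \<open>An element is a finitely supported family whose \<open>n\<close>-th entry is a coset of \<open>I^(n+1)\<close> in \<open>I^n\<close>.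
  The product of the classes of \<open>x \<in> I^i\<close> and \<open>y \<in> I^j\<close> is the class of \<open>x y\<close> modulo
  \<open>I^(i+j+1)\<close>; this is what \<^const>\<open>rcoset_mult\<close> computes when it is given cosets of
  \<open>I^(i+1)\<close> and \<open>I^(j+1)\<close> lying in \<open>I^i\<close> and \<open>I^j\<close>.\<close>

definition assoc_graded :: "('a, 'b) ring_scheme \<Rightarrow> 'a set \<Rightarrow> (nat \<Rightarrow> 'a set) ring" where
  "assoc_graded R I =
     \<lparr>carrier = {g. (\<forall>n. \<exists>x \<in> ideal_power R I n. g n = ideal_power R I (Suc n) +>\<^bsub>R\<^esub> x) \<and>
                    finite {n. g n \<noteq> ideal_power R I (Suc n)}},
      monoid.mult = (\<lambda>g h n. \<Oplus>\<^bsub>R Quot ideal_power R I (Suc n)\<^esub>i\<in>{..n}.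
                rcoset_mult R (ideal_power R I (Suc n)) (g i) (h (n - i))),
      one = (\<lambda>n. if n = 0 then ideal_power R I (Suc 0) +>\<^bsub>R\<^esub> \<one>\<^bsub>R\<^esub> else ideal_power R I (Suc n)),
      ring.zero = (\<lambda>n. ideal_power R I (Suc n)),
      add = (\<lambda>g h n. g n <+>\<^bsub>R\<^esub> h n)\<rparr>"


section \<open>Cohen-Macaulay rings\<close>

definition regular_sequence :: "('a, 'b) ring_scheme \<Rightarrow> 'a list \<Rightarrow> bool" where
  "regular_sequence R xs \<longleftrightarrow>
     set xs \<subseteq> carrier R \<and>
     Idl\<^bsub>R\<^esub> (set xs) \<noteq> carrier R \<and>
     (\<forall>i < length xs. \<forall>y \<in> carrier R.
        xs ! i \<otimes>\<^bsub>R\<^esub> y \<in> Idl\<^bsub>R\<^esub> (set (take i xs)) \<longrightarrow> y \<in> Idl\<^bsub>R\<^esub> (set (take i xs)))"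

definition ideal_depth :: "('a, 'b) ring_scheme \<Rightarrow> 'a set \<Rightarrow> enat" where
  "ideal_depth R J = Sup {enat (length xs) | xs. regular_sequence R xs \<and> set xs \<subseteq> J}"

definition ideal_height :: "('a, 'b) ring_scheme \<Rightarrow> 'a set \<Rightarrow> enat" where
  "ideal_height R P =
     Sup {enat n | n. \<exists>C :: nat \<Rightarrow> 'a set.
            (\<forall>i\<le>n. primeideal (C i) R) \<and> (\<forall>i<n. C i \<subset> C (Suc i)) \<and> C n = P}"

text \<open>This is the definition of Kaplansky (Commutative Rings, Section 3-1) and Eisenbud
  (Commutative Algebra, Section 18.2), which applies to rings that need not be local. For a maximal ideal
  \<open>M\<close> of a Noetherian ring, \<open>ideal_depth R M\<close> and \<open>ideal_height R M\<close> are the depth and the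
  dimension of the localization at \<open>M\<close>.\<close>

definition cohen_macaulay_ring :: "('a, 'b) ring_scheme \<Rightarrow> bool" where
  "cohen_macaulay_ring R \<longleftrightarrow>
     cring R \<and> noetherian_ring R \<and>
     (\<forall>M. maximalideal M R \<longrightarrow> ideal_depth R M = ideal_height R M)"

end

theory Submission
  imports Defs "HOL-Library.Set_Algebras"
begin

text \<open>Since \<open>\<mm>^q\<close> is the conductor \<open>t^(aq) k[[t]]\<close> of \<open>A\<close>, the ideal \<open>I\<close> consists of all elements of \<open>A\<close> of
  order at least \<open>s\<close>, and its powers are monomial. For \<open>n \<ge> 2\<close> the exponents of \<open>I^n\<close> are exactly
  \<open>n s + f\<close> with \<open>f \<le> n \<kappa>\<close> or \<open>f \<ge> a - r\<close>, and \<open>2 \<kappa> + 1 < a - r\<close> is a gap. Hence \<open>t^(3s + 2\<kappa> + 1)\<close> lies in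
  \<open>Q \<inter> I^3\<close> but not in \<open>Q I^2\<close>. For the largest gap \<open>f = a - r - 1\<close> and the largest \<open>N\<close> with \<open>N \<kappa> < f\<close>, the
  initial form of \<open>t^(Ns + f)\<close> in degree \<open>N - 1\<close> is a nonzero element of \<open>G(I)\<close> annihilated by the
  graded maximal ideal. So this maximal ideal has depth zero, while its height is positive.\<close>

section \<open>Monomial ideals of numerical semigroup rings\<close>

text \<open>Arbitrary exponent sets are allowed, so that \<open>A\<close>, its monomial ideals and
  the series of order at least \<open>m\<close> all take the form
  \<open>supported S\<close>.\<close>

definition supported :: "nat set \<Rightarrow> 'k::field fps set" where
  "supported S = {f. \<forall>n. fps_nth f n \<noteq> 0 \<longrightarrow> n \<in> S}"

lemma supportedI: "(\<And>n. fps_nth f n \<noteq> 0 \<Longrightarrow> n \<in> S) \<Longrightarrow> f \<in> supported S"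
  by (simp add: supported_def)

lemma supportedD: "f \<in> supported S \<Longrightarrow> n \<notin> S \<Longrightarrow> fps_nth f n = 0"
  by (auto simp: supported_def)

lemma supported_mono: "S \<subseteq> T \<Longrightarrow> supported S \<subseteq> supported T"
  by (auto simp: supported_def)

lemma supported_zero [simp]: "0 \<in> supported S"
  by (simp add: supported_def)

lemma supported_add: "f \<in> supported S \<Longrightarrow> g \<in> supported S \<Longrightarrow> f + g \<in> supported S"
  by (rule supportedI) (metis add_0 fps_add_nth supportedD)

lemma supported_uminus: "f \<in> supported S \<Longrightarrow> - f \<in> supported S"
  by (auto simp: supported_def)

lemma supported_mult:
  assumes "f \<in> supported S" "g \<in> supported T"
  shows "f * g \<in> supported (S + T)"
proof (rule supportedI)
  fix n assume "fps_nth (f * g) n \<noteq> 0"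
  then obtain i where "i \<le> n" "fps_nth f i * fps_nth g (n - i) \<noteq> 0"
    unfolding fps_mult_nth by (metis (no_types, lifting) atLeastAtMost_iff sum.neutral)
  then have "i \<in> S" "n - i \<in> T" "n = i + (n - i)"
    using assms by (auto simp: supported_def)
  then show "n \<in> S + T"
    by (metis set_plus_intro)
qed

lemma X_power_supported_iff [simp]: "(fps_X ^ n :: 'k::field fps) \<in> supported S \<longleftrightarrow> n \<in> S"
  by (auto simp: supported_def fps_X_power_nth split: if_splits)

lemma fps_const_supported: "0 \<in> S \<Longrightarrow> fps_const c \<in> supported S"
  by (auto simp: supported_def fps_nth_fps_const split: if_splits)

lemma semigroup_ring_simps [simp]:
  "carrier (semigroup_ring H :: 'k::field fps ring) = supported H"
  "monoid.mult (semigroup_ring H :: 'k fps ring) = (*)"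
  "one (semigroup_ring H :: 'k fps ring) = 1"
  "add (semigroup_ring H :: 'k fps ring) = (+)"
  "ring.zero (semigroup_ring H :: 'k fps ring) = 0"
  by (simp_all add: semigroup_ring_def ring_of_type_algebra_def supported_def fun_eq_iff)

lemma fps_split_X_power:
  assumes "f \<in> supported {m + d..}"
  obtains g where "g \<in> supported {d..}" "f = fps_X ^ m * g"
proof
  show "fps_shift m f \<in> supported {d..}"
    using assms by (force simp: supported_def)
  show "f = fps_X ^ m * fps_shift m f"
    by (rule fps_ext) (use assms in \<open>force simp: supported_def fps_X_power_mult_nth\<close>)
qed

locale numerical_semigroup =
  fixes H :: "nat set" and c :: nat
  assumes zero_mem: "0 \<in> H"
    and add_mem: "m \<in> H \<Longrightarrow> n \<in> H \<Longrightarrow> m + n \<in> H"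
    and conductor: "c \<le> n \<Longrightarrow> n \<in> H"
begin

abbreviation A :: "'k::field fps ring" where "A \<equiv> semigroup_ring H"

lemma add_self: "H + H = H"
proof
  show "H + H \<subseteq> H"
    using add_mem by (auto elim: set_plus_elim)
  show "H \<subseteq> H + H"
    using set_plus_intro[OF _ zero_mem, of _ H] by auto
qed

lemma subset_plus: "S \<subseteq> S + H"
  using set_plus_intro[OF _ zero_mem, of _ S] by auto

lemma cring_A: "cring (A :: 'k::field fps ring)"
proof (rule cringI)
  have neg: "\<exists>y\<in>supported H. x + y = 0" if "x \<in> supported H" for x :: "'k fps"
    using supported_uminus[OF that] by (intro bexI[of _ "- x"]) auto
  show "abelian_group (A :: 'k fps ring)"
    by (rule abelian_groupI) (auto simp: supported_add add_ac neg)
  show "comm_monoid (A :: 'k fps ring)"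
    using supported_mult[of _ H _ H]
    by (intro comm_monoidI) (auto simp: add_self mult_ac fps_const_supported[of _ 1, simplified] zero_mem)
qed (simp add: distrib_right)

sublocale A: cring "A :: 'k::field fps ring"
  by (rule cring_A)

lemma a_inv_A: "f \<in> supported H \<Longrightarrow> \<ominus>\<^bsub>A\<^esub> f = - (f :: 'k::field fps)"
  by (intro A.minus_equality) (auto simp: supported_uminus)

lemma finsum_A:
  assumes "finite F" "\<And>i. i \<in> F \<Longrightarrow> x i \<in> supported H"
  shows "finsum A x F = (\<Sum>i\<in>F. x i :: 'k::field fps)"
  using assms
  by (induction F rule: finite_induct) (auto simp: A.finsum_insert Pi_iff)

text \<open>The condition \<open>S + H \<subseteq> S\<close> makes \<open>S\<close> an ideal of the
  semigroup \<open>H\<close>; by \<open>supported_mult\<close> this gives closure under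
  multiplication by \<open>A\<close>.\<close>

lemma ideal_supported:
  assumes "S \<subseteq> H" "S + H \<subseteq> S"
  shows "ideal (supported S) (A :: 'k::field fps ring)"
proof (rule idealI)
  show "ring (A :: 'k fps ring)" by (rule A.ring_axioms)
  show "subgroup (supported S) (add_monoid (A :: 'k fps ring))"
  proof (rule A.add.subgroupI)
    show "supported S \<subseteq> carrier A"
      using supported_mono[OF assms(1)] by simp
    then have "f \<in> supported H" if "f \<in> supported S" for f :: "'k fps"
      using that by auto
    then show "\<ominus>\<^bsub>A\<^esub> f \<in> supported S" if "f \<in> supported S" for f :: "'k fps"
      using that by (simp add: supported_uminus a_inv_A)
    show "supported S \<noteq> ({} :: 'k fps set)" using supported_zero by blast
  qed (auto simp: supported_add)
  fix f x :: "'k fps" assume "f \<in> supported S" "x \<in> carrier A"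
  then have "f * x \<in> supported S"
    using supported_mult[of f S x H] supported_mono[OF assms(2)] by auto
  then show "x \<otimes>\<^bsub>A\<^esub> f \<in> supported S" "f \<otimes>\<^bsub>A\<^esub> x \<in> supported S"
    by (auto simp: mult.commute)
qed

text \<open>A monomial ideal is determined by its monomials only because it contains all series of
  sufficiently large order, so that finitely many monomials remain.\<close>

lemma supported_subset_ideal:
  fixes J :: "'k::field fps set"
  assumes "ideal J A"
    and X: "\<And>n. n \<in> S \<Longrightarrow> fps_X ^ n \<in> J"
    and tail: "supported {m..} \<subseteq> J"
  shows "supported S \<subseteq> J"
proof
  interpret J: ideal J A by fact
  fix f :: "'k fps" assume f: "f \<in> supported S"
  \<comment> \<open>\<open>p k\<close> is the truncation of \<open>f\<close> below degree
    \<open>k\<close>. It lies in \<open>J\<close> as a finite combination of monomials, and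
    \<open>f - p m\<close> falls into the assumed tail.\<close>
  define p where "p k = (\<Sum>n<k. fps_const (fps_nth f n) * fps_X ^ n)" for k
  have "p k \<in> J" for k
  proof (induction k)
    case 0
    then show ?case using J.zero_closed by (simp add: p_def)
  next
    case (Suc k)
    have "fps_const (fps_nth f k) * fps_X ^ k \<in> J"
    proof (cases "k \<in> S")
      case True
      then show ?thesis
        using J.I_l_closed[OF X, of k "fps_const (fps_nth f k)"] by (simp add: fps_const_supported zero_mem)
    next
      case False
      then show ?thesis using f J.zero_closed by (simp add: supportedD)
    qed
    then show ?case using Suc J.a_closed by (auto simp: p_def)
  qed
  moreover have "f - p m \<in> supported {m..}"
  proof (rule supportedI)
    fix n assume "fps_nth (f - p m) n \<noteq> 0"
    moreover have "fps_nth (p m) n = (\<Sum>i<m. if n = i then fps_nth f i else 0)"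
      by (simp add: p_def fps_sum_nth fps_X_power_nth if_distrib cong: if_cong)
    ultimately show "n \<in> {m..}"
      by (auto split: if_splits)
  qed
  ultimately show "f \<in> J"
    using J.a_closed[of "p m" "f - p m"] tail by auto
qed

text \<open>A series of order at least \<open>g + c\<close> is \<open>fps_X ^ g\<close> times a
  series of order at least \<open>c\<close>, which lies in \<open>A\<close>. This supplies the tail
  required by \<open>supported_subset_ideal\<close>.\<close>

lemma genideal_monomials:
  assumes "G \<subseteq> H" "g \<in> G"
  shows "Idl\<^bsub>A\<^esub> ((\<lambda>n. fps_X ^ n) ` G) = (supported (G + H) :: 'k::field fps set)"
proof
  have GH: "G + H \<subseteq> H" "G + H + H \<subseteq> G + H"
    using set_plus_mono2[OF assms(1) subset_refl, of H]
    by (auto simp: add_self add.assoc)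
  show "Idl\<^bsub>A\<^esub> ((\<lambda>n. fps_X ^ n) ` G) \<subseteq> (supported (G + H) :: 'k fps set)"
    using subset_plus[of G] by (intro A.genideal_minimal ideal_supported GH) auto
  have sub: "(\<lambda>n. fps_X ^ n) ` G \<subseteq> carrier (A :: 'k fps ring)"
    using assms by auto
  let ?J = "Idl\<^bsub>A\<^esub> ((\<lambda>n. fps_X ^ n) ` G) :: 'k fps set"
  interpret J: ideal ?J A
    by (rule A.genideal_ideal[OF sub])
  have X: "fps_X ^ n * x \<in> ?J" if "n \<in> G" "x \<in> supported H" for n x
    using J.I_r_closed[of "fps_X ^ n" x] A.genideal_self[OF sub] that by auto
  show "supported (G + H) \<subseteq> ?J"
  proof (rule supported_subset_ideal)
    show "fps_X ^ n \<in> ?J" if "n \<in> G + H" for n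
      using that X by (auto elim!: set_plus_elim simp: power_add)
    show "supported {g + c..} \<subseteq> ?J"
    proof
      fix f :: "'k fps" assume "f \<in> supported {g + c..}"
      then obtain h where h: "h \<in> supported {c..}" "f = fps_X ^ g * h"
        by (rule fps_split_X_power)
      have "supported {c..} \<subseteq> (supported H :: 'k fps set)"
        using conductor by (intro supported_mono) auto
      with h X assms show "f \<in> ?J" by auto
    qed
  qed (rule J.is_ideal)
qed

text \<open>The tail starts at \<open>s + (t + c)\<close>: after splitting off
  \<open>fps_X ^ s\<close>, all exponents are at least \<open>t + c\<close> and hence lie in
  \<open>T\<close>.\<close>

lemma ideal_prod_supported:
  assumes S: "S \<subseteq> H" "S + H \<subseteq> S" "S \<noteq> {}" and T: "T \<subseteq> H" "T + H \<subseteq> T" "T \<noteq> {}"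
  shows "ideal_prod A (supported S) (supported T) = (supported (S + T) :: 'k::field fps set)"
    (is "?P = _")
proof
  show "?P \<subseteq> supported (S + T)"
  proof
    fix f assume "f \<in> ?P"
    then show "f \<in> supported (S + T)"
      by induction (auto simp: supported_mult supported_add)
  qed
  obtain s t where st: "s \<in> S" "t \<in> T" using S T by blast
  show "supported (S + T) \<subseteq> ?P"
  proof (rule supported_subset_ideal)
    show "ideal ?P A"
      by (intro A.ideal_prod_is_ideal ideal_supported S T)
    have prod: "f * g \<in> ?P" if "f \<in> supported S" "g \<in> supported T" for f g
      using ideal_prod.prod[of f "supported S" g "supported T" A] that by simp
    show "fps_X ^ n \<in> ?P" if "n \<in> S + T" for n
      using that prod by (auto elim!: set_plus_elim simp: power_add)
    show "supported {s + (t + c)..} \<subseteq> ?P"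
    proof
      fix f :: "'k fps" assume "f \<in> supported {s + (t + c)..}"
      then obtain h where h: "h \<in> supported {t + c..}" "f = fps_X ^ s * h"
        by (rule fps_split_X_power)
      have "n \<in> T" if n: "t + c \<le> n" for n
      proof -
        have "n = t + (n - t)" "n - t \<in> H" using n conductor by auto
        then show ?thesis using st T(2) by (metis set_plus_intro subsetD)
      qed
      then have "supported {t + c..} \<subseteq> (supported T :: 'k fps set)"
        by (intro supported_mono) auto
      with h st prod show "f \<in> ?P" by auto
    qed
  qed
qed

text \<open>The recursion starts from \<open>H\<close> rather than \<open>{0}\<close>, because the
  zeroth power of an ideal is the whole ring.\<close>

fun sum_power :: "nat set \<Rightarrow> nat \<Rightarrow> nat set" where
  "sum_power S 0 = H"
| "sum_power S (Suc n) = sum_power S n + S"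

lemma sum_power_closed:
  assumes "S \<subseteq> H" "S + H \<subseteq> S" "S \<noteq> {}"
  shows "sum_power S n \<subseteq> H" "sum_power S n + H \<subseteq> sum_power S n" "sum_power S n \<noteq> {}"
proof (induction n)
  case 0
  {
    case 1 show ?case by simp
  next
    case 2 show ?case by (simp add: add_self)
  next
    case 3 show ?case using zero_mem by auto
  }
next
  case (Suc n)
  {
    case 1
    show ?case using set_plus_mono2[OF Suc(1) assms(1)] by (simp add: add_self)
  next
    case 2
    show ?case using set_plus_mono2[OF subset_refl assms(2), of "sum_power S n"] by (simp add: add.assoc)
  next
    case 3
    show ?case using Suc(3) assms(3) by (auto simp: set_plus_def)
  }
qed

lemma ideal_power_supported:
  assumes "S \<subseteq> H" "S + H \<subseteq> S" "S \<noteq> {}"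
  shows "ideal_power A (supported S) n = (supported (sum_power S n) :: 'k::field fps set)"
proof (induction n)
  case 0
  then show ?case by (simp add: nat_pow_def ideals_set_def)
next
  case (Suc n)
  have "ideal_power A (supported S) (Suc n)
      = ideal_prod A (ideal_power A (supported S) n) (supported S :: 'k fps set)"
    by (simp add: nat_pow_def ideals_set_def)
  then show ?case
    using Suc assms sum_power_closed[OF assms] by (simp add: ideal_prod_supported)
qed

end

section \<open>Associated graded rings\<close>

text \<open>Powers with a successor exponent stay folded, in the form in which
  \<open>assoc_graded\<close> mentions them.\<close>

declare Group.nat_pow_Suc [simp del]

locale cring_ideal = ideal I R + cring R for I and R (structure)
begin

abbreviation pw :: "nat \<Rightarrow> 'a set" where "pw n \<equiv> ideal_power R I n"

lemma pw_Suc: "pw (Suc n) = ideal_prod R (pw n) I"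
  by (simp add: nat_pow_def ideals_set_def)

lemma ideal_pw: "ideal (pw n) R"
proof (induction n)
  case 0
  then show ?case by (simp add: nat_pow_def ideals_set_def oneideal)
next
  case (Suc n)
  then show ?case using ideal_prod_is_ideal[OF Suc is_ideal] by (simp only: pw_Suc)
qed

lemma pw_carrier: "x \<in> pw n \<Longrightarrow> x \<in> carrier R"
  by (rule ideal.Icarr[OF ideal_pw])

lemma pw_zero: "\<zero> \<in> pw n"
  by (rule additive_subgroup.zero_closed[OF ideal.axioms(1)[OF ideal_pw]])

lemma pw_antimono: "m \<le> n \<Longrightarrow> pw n \<subseteq> pw m"
proof (induction rule: dec_induct)
  case (step n)
  then show ?case using ideal_prod_inter[OF ideal_pw[of n] is_ideal] by (auto simp: pw_Suc)
qed simp

lemma pw_mult: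
  assumes "x \<in> pw m" "y \<in> pw n"
  shows "x \<otimes> y \<in> pw (m + n)"
proof -
  interpret S: comm_monoid "ideals_set R" by (rule ideals_set_is_comm_monoid)
  have "ideal_prod R (pw m) (pw n) = pw (m + n)"
    using S.nat_pow_mult[of I m n] is_ideal by (simp add: ideals_set_def)
  then show ?thesis using ideal_prod.prod[OF assms, of R] by simp
qed

lemma pw_coset_cong:
  assumes "x \<in> carrier R" "y \<in> pw n +> x"
  shows "pw n +> y = pw n +> x"
proof -
  interpret J: ideal "pw n" R by (rule ideal_pw)
  show ?thesis using a_repr_independence[OF assms(2,1) J.a_subgroup] by (rule sym)
qed

lemma pw_coset_self: "x \<in> carrier R \<Longrightarrow> x \<in> pw n +> x"
proof -
  interpret J: ideal "pw n" R by (rule ideal_pw)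
  show "x \<in> carrier R \<Longrightarrow> ?thesis" by (rule J.a_rcos_self)
qed

lemma pw_coset_eq_iff: "x \<in> carrier R \<Longrightarrow> pw n +> x = pw n \<longleftrightarrow> x \<in> pw n"
proof -
  interpret J: ideal "pw n" R by (rule ideal_pw)
  show "x \<in> carrier R \<Longrightarrow> ?thesis" using pw_coset_self[of x n] J.a_rcos_const[of x] by auto
qed

lemma pw_finsum: "finite F \<Longrightarrow> (\<And>i. i \<in> F \<Longrightarrow> x i \<in> pw n) \<Longrightarrow> finsum R x F \<in> pw n"
proof (induction F rule: finite_induct)
  case empty
  then show ?case by (simp add: pw_zero)
next
  case (insert i F)
  then have "x i \<oplus> finsum R x F \<in> pw n"
    by (intro additive_subgroup.a_closed[OF ideal.axioms(1)[OF ideal_pw]]) simp_all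
  moreover have "x \<in> F \<rightarrow> carrier R" "x i \<in> carrier R"
    using insert.prems pw_carrier by blast+
  ultimately show ?case
    using insert.hyps by simp
qed

text \<open>For representatives \<open>u \<oplus> x\<close> and \<open>v \<oplus> y\<close>, the
  product differs from \<open>x \<otimes> y\<close> by terms that each contain \<open>u\<close> or
  \<open>v\<close> and therefore lie in the power \<open>Suc (i + j)\<close>. So all cosets in the
  union defining \<open>rcoset_mult\<close> coincide.\<close>

lemma rcoset_mult_pw:
  assumes x: "x \<in> pw i" and y: "y \<in> pw j"
  shows "rcoset_mult R (pw (Suc (i + j))) (pw (Suc i) +> x) (pw (Suc j) +> y)
       = pw (Suc (i + j)) +> (x \<otimes> y)"
proof -
  let ?J = "pw (Suc (i + j))"
  interpret J: ideal ?J R by (rule ideal_pw)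
  have eq: "?J +> (a \<otimes> b) = ?J +> (x \<otimes> y)" if ab: "a \<in> pw (Suc i) +> x" "b \<in> pw (Suc j) +> y" for a b
  proof -
    obtain u v where u: "u \<in> pw (Suc i)" "a = u \<oplus> x" and v: "v \<in> pw (Suc j)" "b = v \<oplus> y"
      using ab by (auto simp: a_r_coset_def')
    note [simp] = pw_carrier[OF x] pw_carrier[OF y] pw_carrier[OF u(1)] pw_carrier[OF v(1)]
    have "u \<otimes> v \<in> ?J" "u \<otimes> y \<in> ?J" "x \<otimes> v \<in> ?J"
      using pw_mult[OF u(1) v(1)] pw_antimono[of "Suc (i + j)" "Suc i + Suc j"]
        pw_mult[OF u(1) y] pw_mult[OF x v(1)] by auto
    then have "(u \<otimes> v \<oplus> u \<otimes> y \<oplus> x \<otimes> v) \<in> ?J"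
      by (intro J.a_closed)
    moreover have "a \<otimes> b = (u \<otimes> v \<oplus> u \<otimes> y \<oplus> x \<otimes> v) \<oplus> x \<otimes> y"
      by (simp add: u v l_distr r_distr a_ac)
    ultimately show ?thesis
      by (intro pw_coset_cong) (auto simp: a_r_coset_def')
  qed
  \<comment> \<open>Both index cosets are nonempty, so the union of the constant family is its
    value.\<close>
  have "x \<in> pw (Suc i) +> x" "y \<in> pw (Suc j) +> y"
    using pw_carrier[OF x] pw_carrier[OF y] by (auto intro: pw_coset_self)
  moreover have "(\<Union>a\<in>pw (Suc i) +> x. \<Union>b\<in>pw (Suc j) +> y. ?J +> (a \<otimes> b))
      = (\<Union>a\<in>pw (Suc i) +> x. \<Union>b\<in>pw (Suc j) +> y. ?J +> (x \<otimes> y))"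
    by (intro SUP_cong refl eq)
  ultimately show ?thesis
    unfolding rcoset_mult_def by blast
qed

lemma finsum_cosets:
  assumes "finite F" "\<And>i. i \<in> F \<Longrightarrow> x i \<in> carrier R"
  shows "finsum (R Quot pw n) (\<lambda>i. pw n +> x i) F = pw n +> finsum R x F"
proof -
  interpret h: ring_hom_ring R "R Quot pw n" "(+>) (pw n)"
    by (rule ideal.rcos_ring_hom_ring[OF ideal_pw])
  show ?thesis
    using h.hom_finsum[of x F] assms by (auto simp: Pi_iff comp_def)
qed

abbreviation G :: "(nat \<Rightarrow> 'a set) ring" where "G \<equiv> assoc_graded R I"

lemma G_carrier_reps:
  "g \<in> carrier G \<Longrightarrow> \<exists>x. \<forall>n. x n \<in> pw n \<and> g n = pw (Suc n) +> x n"
  by (rule choice) (auto simp: assoc_graded_def)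

text \<open>This replaces a sum of coset products in a quotient ring by one sum of representatives
  in \<open>R\<close>, where products in \<open>G\<close> are then computed.\<close>

lemma G_mult_eq:
  assumes "\<And>n. x n \<in> pw n" "\<And>n. g n = pw (Suc n) +> x n"
    and "\<And>n. y n \<in> pw n" "\<And>n. h n = pw (Suc n) +> y n"
  shows "(g \<otimes>\<^bsub>G\<^esub> h) n = pw (Suc n) +> (\<Oplus>i\<in>{..n}. x i \<otimes> y (n - i))"
proof -
  interpret Q: ring "R Quot pw (Suc n)" by (rule ideal.quotient_is_ring[OF ideal_pw])
  have "(g \<otimes>\<^bsub>G\<^esub> h) n
      = (\<Oplus>\<^bsub>R Quot pw (Suc n)\<^esub>i\<in>{..n}. rcoset_mult R (pw (Suc n)) (g i) (h (n - i)))"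
    by (simp add: assoc_graded_def)
  also have "\<dots> = (\<Oplus>\<^bsub>R Quot pw (Suc n)\<^esub>i\<in>{..n}. pw (Suc n) +> (x i \<otimes> y (n - i)))"
  proof (rule Q.finsum_cong')
    show "(\<lambda>i. pw (Suc n) +> (x i \<otimes> y (n - i))) \<in> {..n} \<rightarrow> carrier (R Quot pw (Suc n))"
      using assms(1,3)[THEN pw_carrier] ring_hom_closed[OF ideal.rcos_ring_hom[OF ideal_pw[of "Suc n"]]]
      by auto
    fix i assume "i \<in> {..n}"
    then show "rcoset_mult R (pw (Suc n)) (g i) (h (n - i)) = pw (Suc n) +> (x i \<otimes> y (n - i))"
      using rcoset_mult_pw[OF assms(1)[of i] assms(3)[of "n - i"]] assms(2,4) by simp
  qed simp
  also have "\<dots> = pw (Suc n) +> (\<Oplus>i\<in>{..n}. x i \<otimes> y (n - i))"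
    using assms(1,3)[THEN pw_carrier] by (intro finsum_cosets) auto
  finally show ?thesis .
qed

lemma G_add_eq:
  assumes "x \<in> pw n" "g n = pw (Suc n) +> x" "y \<in> pw n" "h n = pw (Suc n) +> y"
  shows "(g \<oplus>\<^bsub>G\<^esub> h) n = pw (Suc n) +> (x \<oplus> y)"
proof -
  interpret J: ideal "pw (Suc n)" R by (rule ideal_pw)
  show ?thesis
    using J.a_rcos_sum[OF pw_carrier[OF assms(1)] pw_carrier[OF assms(3)]] assms(2,4)
    by (simp add: assoc_graded_def)
qed

text \<open>The degree \<open>j\<close> is an explicit argument: the class of \<open>x\<close> in
  degree \<open>j\<close> is zero when \<open>x\<close> already lies in the next power.\<close>

definition init_form :: "nat \<Rightarrow> 'a \<Rightarrow> nat \<Rightarrow> 'a set" where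
  "init_form j x = (\<lambda>n. pw (Suc n) +> (if n = j then x else \<zero>))"

lemma init_form_closed:
  assumes "x \<in> pw j"
  shows "init_form j x \<in> carrier G"
proof -
  have "init_form j x n = pw (Suc n)" if "n \<noteq> j" for n
    using that pw_coset_eq_iff[of \<zero> "Suc n"] by (simp add: init_form_def pw_zero)
  then have "{n. init_form j x n \<noteq> pw (Suc n)} \<subseteq> {j}" by blast
  then have "finite {n. init_form j x n \<noteq> pw (Suc n)}" by (rule finite_subset) simp
  moreover have "\<exists>y\<in>pw n. init_form j x n = pw (Suc n) +> y" for n
    using assms pw_zero[of n] by (auto simp: init_form_def)
  ultimately show ?thesis by (simp add: assoc_graded_def)
qed

lemma init_form_eq_zero_iff:
  assumes "x \<in> pw j"
  shows "init_form j x = \<zero>\<^bsub>G\<^esub> \<longleftrightarrow> x \<in> pw (Suc j)"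
proof -
  have "init_form j x = \<zero>\<^bsub>G\<^esub> \<longleftrightarrow> (\<forall>n. (if n = j then x else \<zero>) \<in> pw (Suc n))"
    using pw_carrier[OF assms]
    by (simp add: assoc_graded_def init_form_def fun_eq_iff pw_coset_eq_iff)
  then show ?thesis by (auto simp: pw_zero)
qed

lemma one_eq_init_form: "\<one>\<^bsub>G\<^esub> = init_form 0 \<one>"
proof
  show "\<one>\<^bsub>G\<^esub> n = init_form 0 \<one> n" for n
    using pw_coset_eq_iff[of \<zero> "Suc n"] by (simp add: assoc_graded_def init_form_def pw_zero)
qed

text \<open>In degree \<open>n\<close> of the product only the summand with \<open>n - i = j\<close>
  can be nonzero, and \<open>zy\<close> places it in the power \<open>Suc n\<close>.\<close>

lemma init_form_annihilates:
  assumes z: "z \<in> pw j" and y: "\<And>n. y n \<in> pw n" and g: "\<And>n. g n = pw (Suc n) +> y n"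
    and zy: "\<And>n. z \<otimes> y n \<in> pw (Suc (j + n))"
  shows "g \<otimes>\<^bsub>G\<^esub> init_form j z = \<zero>\<^bsub>G\<^esub>"
proof
  fix n
  let ?z = "\<lambda>n. if n = j then z else \<zero>"
  interpret J: ideal "pw (Suc n)" R by (rule ideal_pw)
  have "(g \<otimes>\<^bsub>G\<^esub> init_form j z) n = pw (Suc n) +> (\<Oplus>i\<in>{..n}. y i \<otimes> ?z (n - i))"
    using z pw_zero by (intro G_mult_eq y g) (auto simp: init_form_def)
  moreover have "y i \<otimes> ?z (n - i) \<in> pw (Suc n)" if "i \<le> n" for i
    using zy[of i] that pw_carrier[OF y, of i] pw_carrier[OF z] J.zero_closed
    by (auto simp: m_comm)
  then have "(\<Oplus>i\<in>{..n}. y i \<otimes> ?z (n - i)) \<in> pw (Suc n)"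
    by (intro pw_finsum) auto
  ultimately show "(g \<otimes>\<^bsub>G\<^esub> init_form j z) n = \<zero>\<^bsub>G\<^esub> n"
    using pw_coset_eq_iff[OF J.Icarr] by (simp add: assoc_graded_def)
qed

end

section \<open>A criterion for a ring not to be Cohen-Macaulay\<close>

lemma ring_of_type_algebra_simps [simp]:
  "carrier (ring_of_type_algebra :: 'a::ring_1 ring) = UNIV"
  "monoid.mult (ring_of_type_algebra :: 'a ring) = (*)"
  "one (ring_of_type_algebra :: 'a ring) = 1"
  "add (ring_of_type_algebra :: 'a ring) = (+)"
  "ring.zero (ring_of_type_algebra :: 'a ring) = 0"
  by (simp_all add: ring_of_type_algebra_def fun_eq_iff)

lemma a_inv_ring_of_type_algebra [simp]:
  "\<ominus>\<^bsub>ring_of_type_algebra\<^esub> x = - (x :: 'a::comm_ring_1)"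
proof -
  have "abelian_group (ring_of_type_algebra :: 'a ring)"
    using ring_from_type_algebra by (rule ring.is_abelian_group)
  then show ?thesis by (rule abelian_group.minus_equality) auto
qed

text \<open>The kernel of \<open>\<phi>\<close> is a prime ideal strictly below the maximal ideal of all elements \<open>g\<close> for which
  \<open>\<phi> g\<close> has no constant term, so that maximal ideal has positive height; as \<open>z\<close> annihilates it, its
  depth is zero.\<close>

lemma (in cring) not_cohen_macaulay_if_socle:
  fixes \<phi> :: "'a \<Rightarrow> 'k::field fps"
  assumes hom: "\<phi> \<in> ring_hom R ring_of_type_algebra"
    and const: "\<And>c. \<exists>g\<in>carrier R. \<phi> g = fps_const c"
    and t: "t \<in> carrier R" "\<phi> t \<noteq> 0" "fps_nth (\<phi> t) 0 = 0"
    and z: "z \<in> carrier R" "z \<noteq> \<zero>"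
    and ann: "\<And>g. g \<in> carrier R \<Longrightarrow> fps_nth (\<phi> g) 0 = 0 \<Longrightarrow> g \<otimes> z = \<zero>"
  shows "\<not> cohen_macaulay_ring R"
proof
  assume CM: "cohen_macaulay_ring R"
  interpret h: ring_hom_ring R "ring_of_type_algebra :: 'k fps ring" \<phi>
    by (rule ring_hom_ringI2) (use hom in \<open>auto intro: ring_from_type_algebra local.ring_axioms\<close>)
  define P where "P = {g \<in> carrier R. \<phi> g = 0}"
  define M where "M = {g \<in> carrier R. fps_nth (\<phi> g) 0 = 0}"
  have mult: "\<phi> (x \<otimes> y) = \<phi> x * \<phi> y" if "x \<in> carrier R" "y \<in> carrier R" for x y
    using h.hom_mult that by simp
  have add: "\<phi> (x \<oplus> y) = \<phi> x + \<phi> y" if "x \<in> carrier R" "y \<in> carrier R" for x y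
    using h.hom_add that by simp
  have one: "\<phi> \<one> = 1" using h.hom_one by simp
  have inv: "\<phi> (\<ominus> x) = - \<phi> x" if "x \<in> carrier R" for x
    using add[of x "\<ominus> x"] h.hom_zero that by (simp add: r_neg eq_neg_iff_add_eq_0 add.commute)

  have zero: "\<phi> \<zero> = 0" using h.hom_zero by simp
  have idealP: "ideal P R"
    by (rule idealI[OF local.ring_axioms add.subgroupI])
      (auto simp: P_def mult add inv zero)
  have idealM: "ideal M R"
    by (rule idealI[OF local.ring_axioms add.subgroupI])
      (auto simp: M_def mult add inv zero)
  have primeP: "primeideal P R"
  proof (rule primeidealI[OF idealP cring_axioms])
    show "carrier R \<noteq> P" using t by (auto simp: P_def)
  qed (auto simp: P_def mult)
  have maxM: "maximalideal M R"
  proof (rule maximalidealI[OF idealM])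
    have "\<one> \<notin> M" using one by (simp add: M_def)
    then show "carrier R \<noteq> M" using one_closed by blast
    fix J assume J: "ideal J R" "M \<subseteq> J" "J \<subseteq> carrier R"
    interpret J: ideal J R by fact
    have "J = carrier R" if neq: "J \<noteq> M"
    proof -
      obtain g where g: "g \<in> J" "fps_nth (\<phi> g) 0 \<noteq> 0"
        using neq J by (auto simp: M_def)
      \<comment> \<open>The image of \<open>e\<close> inverts the constant term of
        \<open>\<phi> g\<close>, so \<open>\<one> \<ominus> e \<otimes> g\<close> lies in
        \<open>M\<close> and hence in \<open>J\<close>.\<close>
      obtain e where e: "e \<in> carrier R" "\<phi> e = fps_const (inverse (fps_nth (\<phi> g) 0))"
        using const by blast
      have eg: "e \<otimes> g \<in> J" using J.I_l_closed g e by blast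
      have "\<one> \<ominus> e \<otimes> g \<in> M"
        using g e J.Icarr[OF g(1)] by (simp add: M_def minus_eq add inv one mult)
      then have "(\<one> \<ominus> e \<otimes> g) \<oplus> e \<otimes> g \<in> J"
        using J.a_closed eg J by blast
      then have "\<one> \<in> J"
        using J.Icarr[OF eg] by (simp add: minus_eq a_assoc l_neg)
      then show ?thesis by (rule J.one_imp_carrier)
    qed
    then show "J = M \<or> J = carrier R" by blast
  qed
  have "P \<subset> M"
    using t by (auto simp: P_def M_def)
  define C where "C i = (if i = 0 then P else M)" for i :: nat
  have "(\<forall>i\<le>1. primeideal (C i) R) \<and> (\<forall>i<1. C i \<subset> C (Suc i)) \<and> C 1 = M"
    using primeP maximalideal_prime[OF maxM] \<open>P \<subset> M\<close> by (simp add: C_def)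
  then have "enat 1 \<le> ideal_height R M"
    unfolding ideal_height_def by (intro Sup_upper) blast
  \<comment> \<open>The first entry of a nonempty regular sequence is a nonzerodivisor, but every
    element of \<open>M\<close> kills \<open>z \<noteq> \<zero>\<close>.\<close>
  moreover have "xs = []" if xs: "regular_sequence R xs" "set xs \<subseteq> M" for xs
  proof (cases xs)
    case (Cons x ys)
    have Idl: "Idl {} = {\<zero>}"
      using genideal_minimal[OF zeroideal, of "{}"]
        additive_subgroup.zero_closed[OF ideal.axioms(1)[OF genideal_ideal[of "{}"]]]
      by auto
    have "x \<otimes> z \<in> Idl {} \<longrightarrow> z \<in> Idl {}"
      using xs(1) z unfolding regular_sequence_def Cons by force
    moreover have "x \<otimes> z = \<zero>"
      using ann[of x] xs(2) by (auto simp: Cons M_def)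
    ultimately show ?thesis using z by (simp add: Idl)
  qed simp
  then have "ideal_depth R M \<le> 0"
    unfolding ideal_depth_def by (intro Sup_least) (auto simp: zero_enat_def)
  moreover have "ideal_depth R M = ideal_height R M"
    using CM maxM by (simp add: cohen_macaulay_ring_def)
  ultimately show False by (simp add: enat_0_iff)
qed

section \<open>The semigroup generated by two consecutive numbers\<close>

text \<open>Put \<open>i = \<alpha> + \<beta>\<close> and \<open>j = \<beta>\<close>. The semigroup
  is thus the union of the blocks from \<open>a * i\<close> to \<open>a * i + i\<close>.\<close>

lemma consecutive_semigroup_iff:
  "n \<in> consecutive_semigroup a \<longleftrightarrow> (\<exists>i j. n = a * i + j \<and> j \<le> i)"
proof
  assume "n \<in> consecutive_semigroup a"
  then obtain u v where "n = u * a + v * (a + 1)" by (auto simp: consecutive_semigroup_def)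
  then have "n = a * (u + v) + v \<and> v \<le> u + v" by (simp add: algebra_simps)
  then show "\<exists>i j. n = a * i + j \<and> j \<le> i" by blast
next
  assume "\<exists>i j. n = a * i + j \<and> j \<le> i"
  then obtain i j where ij: "n = a * i + j" "j \<le> i" by blast
  then obtain d where "i = d + j" by (metis le_add_diff_inverse2)
  with ij have "n = d * a + j * (a + 1)" by (simp add: algebra_simps)
  then show "n \<in> consecutive_semigroup a" by (auto simp: consecutive_semigroup_def)
qed

text \<open>Below index \<open>u\<close> the first factor vanishes, and beyond \<open>u\<close> the
  complementary index drops below \<open>v\<close>. This is what makes \<open>lowest\<close>
  multiplicative.\<close>

lemma fps_mult_nth_lowest:
  fixes f g :: "'k::field fps"
  assumes "f \<in> supported {u..}" "g \<in> supported {v..}"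
  shows "fps_nth (f * g) (u + v) = fps_nth f u * fps_nth g v"
proof -
  have "fps_nth f i * fps_nth g (u + v - i) = (if i = u then fps_nth f u * fps_nth g v else 0)"
    if "i \<le> u + v" for i
    using assms[THEN supportedD] that by (cases i u rule: linorder_cases) auto
  then have "fps_nth (f * g) (u + v)
      = (\<Sum>i=0..u + v. if i = u then fps_nth f u * fps_nth g v else 0)"
    unfolding fps_mult_nth by (intro sum.cong) auto
  then show ?thesis by simp
qed

text \<open>The assumption \<open>a_ge\<close> is \<open>l + \<kappa> + 2 \<le> a\<close> with
  \<open>\<kappa> = l - r\<close> cleared of subtraction.\<close>

locale two_generated =
  fixes a l r :: nat
  assumes r: "0 < r" "r < l" and l: "l < a - 1" and a_le: "a \<le> 2 * l + 1"
    and a_ge: "2 * l + 2 \<le> a + r"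
begin

definition "H = consecutive_semigroup a"
definition "s = a * l + r"
definition "\<kappa> = l - r"
definition "E = {n \<in> H. s \<le> n}"

lemma H_I: "j \<le> i \<Longrightarrow> a * i + j \<in> H"
  by (auto simp: H_def consecutive_semigroup_iff)

lemma H_E: "n \<in> H \<Longrightarrow> (\<And>i j. n = a * i + j \<Longrightarrow> j \<le> i \<Longrightarrow> P) \<Longrightarrow> P"
  unfolding H_def consecutive_semigroup_iff by blast

lemma conductor_mem:
  assumes "a * (a - 1) \<le> n" shows "n \<in> H"
proof -
  have a: "0 < a" using l by simp
  then have "a - 1 \<le> n div a" using assms by (simp add: less_eq_div_iff_mult_less_eq mult.commute)
  moreover have "n mod a < a" using a by simp
  ultimately have "n mod a \<le> n div a" by linarith
  from H_I[OF this] show ?thesis by simp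
qed

text \<open>A block with \<open>i < a - 1\<close> would need \<open>j \<ge> a - 1 > i\<close> to
  reach this number. The gap is the Frobenius number of \<open>H\<close>, and it bounds the orders
  in the ideal quotient from below.\<close>

lemma frobenius_not_mem: "a * (a - 1) - 1 \<notin> H"
proof
  assume "a * (a - 1) - 1 \<in> H"
  then obtain i j where ij: "a * (a - 1) - 1 = a * i + j" "j \<le> i" by (rule H_E)
  have "2 \<le> a" using l by linarith
  then have pos: "0 < a * (a - 1)" by simp
  then have "a * i < a * (a - 1)" using ij by linarith
  then have i: "i < a - 1" by simp
  then have "a * (i + 1) \<le> a * (a - 1)" by (intro mult_le_mono2) simp
  then have "a * i + a \<le> a * (a - 1)" by simp
  then have "a \<le> j + 1" using ij pos by linarith
  then show False using ij i by simp
qed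

sublocale numerical_semigroup H "a * (a - 1)"
proof
  show "0 \<in> H" using H_I[of 0 0] by simp
  show "m + n \<in> H" if "m \<in> H" "n \<in> H" for m n
  proof -
    from that(1) obtain i j where "m = a * i + j" "j \<le> i" by (rule H_E)
    moreover from that(2) obtain i' j' where "n = a * i' + j'" "j' \<le> i'" by (rule H_E)
    ultimately have "m + n = a * (i + i') + (j + j')" "j + j' \<le> i + i'" by (simp_all add: distrib_left)
    then show ?thesis by (simp only: H_I)
  qed
qed (rule conductor_mem)

lemma s_mem: "s \<in> H"
  using H_I[of r l] r by (simp add: s_def)

lemma s_less: "s < a * (a - 1)"
proof -
  have "s < a * (l + 1)" using r l by (simp add: s_def)
  also have "\<dots> \<le> a * (a - 1)" using l by (intro mult_le_mono2) simp
  finally show ?thesis .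
qed

text \<open>Here \<open>a \<le> 2 * l + 1\<close> enters: every exponent from \<open>2 * s\<close>
  on lies in \<open>H\<close>.\<close>

lemma two_s_ge: "a * (a - 1) \<le> 2 * s"
proof -
  have "a * (a - 1) \<le> a * (2 * l)" using a_le by (intro mult_le_mono2) simp
  also have "\<dots> \<le> 2 * s" by (simp add: s_def)
  finally show ?thesis .
qed

lemma a_le_s: "a \<le> s"
proof -
  have "a * 1 \<le> a * l" using r by (intro mult_le_mono2) simp
  then show ?thesis unfolding s_def by linarith
qed

lemma E_sub: "E \<subseteq> H" and E_closed: "E + H \<subseteq> E" and E_nonempty: "E \<noteq> {}"
proof -
  show "E \<subseteq> H" by (auto simp: E_def)
  show "E + H \<subseteq> E" using add_mem by (auto simp: E_def elim!: set_plus_elim)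
  show "E \<noteq> {}" using s_mem by (auto simp: E_def)
qed

lemma gens_mem: "{a, a + 1} \<subseteq> H"
  using H_I[of 0 1] H_I[of 1 1] by simp

section \<open>The maximal ideal, its powers and the ideal quotient\<close>

definition "M = {a, a + 1} + H"

lemma M_cases:
  assumes "m \<in> M"
  obtains g h where "m = a + g + h" "g \<le> 1" "h \<in> H"
  using assms unfolding M_def by (auto elim!: set_plus_elim intro: that[of 0] that[of 1])

lemma M_I:
  assumes "g \<le> 1" "h \<in> H"
  shows "a + g + h \<in> M"
proof -
  have "a + g \<in> {a, a + 1}" using assms by auto
  then show ?thesis using assms(2) unfolding M_def by (rule set_plus_intro)
qed

lemma genideal_maximal:
  "Idl\<^bsub>A\<^esub> {fps_X ^ a, fps_X ^ (a + 1)} = (supported M :: 'k::field fps set)"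
  using genideal_monomials[OF gens_mem insertI1] by (simp only: image_insert image_empty M_def)

lemma genideal_s: "Idl\<^bsub>A\<^esub> {fps_X ^ s} = (supported ({s} + H) :: 'k::field fps set)"
proof -
  have "{s} \<subseteq> H" using s_mem by blast
  from genideal_monomials[OF this singletonI] show ?thesis by (simp only: image_insert image_empty)
qed

lemma M_closed: "M \<subseteq> H" "M + H \<subseteq> M" "M \<noteq> {}"
proof -
  show "M \<subseteq> H"
    using set_plus_mono2[OF gens_mem subset_refl, of H] unfolding add_self M_def .
  show "M + H \<subseteq> M" by (simp only: M_def add.assoc add_self order_refl)
  show "M \<noteq> {}" using M_I[of 0 0] zero_mem by blast
qed

text \<open>In \<open>a * i + j\<close> the number \<open>i\<close> counts the generators used and
  \<open>j\<close> those equal to \<open>a + 1\<close>; the \<open>n\<close>-th power asks for a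
  representation with at least \<open>n\<close> generators.\<close>

lemma sum_power_M:
  "sum_power M n = {m. \<exists>i j. m = a * i + j \<and> j \<le> i \<and> n \<le> i}"
proof (induction n)
  case 0
  then show ?case by (auto simp: H_I elim: H_E)
next
  case (Suc n)
  show ?case
  proof (intro equalityI subsetI)
    fix m assume "m \<in> sum_power M (Suc n)"
    then obtain u g h where "u \<in> sum_power M n" "h \<in> H" "g \<le> 1" "m = u + (a + g + h)"
      by (auto elim!: set_plus_elim M_cases)
    moreover from this obtain i j where "u = a * i + j" "j \<le> i" "n \<le> i" by (auto simp: Suc)
    moreover from calculation obtain i' j' where "h = a * i' + j'" "j' \<le> i'" by (auto elim: H_E)
    ultimately have ij: "j \<le> i" "n \<le> i" "g \<le> 1" "j' \<le> i'"
      "m = (a * i + j) + ((a + g) + (a * i' + j'))" by auto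
    then have "m = a * (i + i' + 1) + (j + j' + g) \<and> j + j' + g \<le> i + i' + 1 \<and> Suc n \<le> i + i' + 1"
      by (simp add: algebra_simps)
    then show "m \<in> {m. \<exists>i j. m = a * i + j \<and> j \<le> i \<and> Suc n \<le> i}" by blast
  next
    fix m assume "m \<in> {m. \<exists>i j. m = a * i + j \<and> j \<le> i \<and> Suc n \<le> i}"
    then obtain i' j where "m = a * i' + j" "j \<le> i'" "Suc n \<le> i'" by blast
    moreover from this(3) obtain i where "i' = Suc i" by (cases i') auto
    ultimately have ij: "m = a * Suc i + j" "j \<le> Suc i" "n \<le> i" by auto
    \<comment> \<open>The generator split off is \<open>a\<close>, except when
      \<open>j = Suc i\<close> and all generators are \<open>a + 1\<close>.\<close>
    obtain g where g: "g \<le> 1" "g \<le> j" "j - g \<le> i"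
      using ij(2) by (cases "j \<le> i") (auto intro: that[of 0] that[of 1])
    have "a * i + (j - g) \<in> sum_power M n"
      using ij(3) g(3) unfolding Suc by blast
    moreover have "(a + g) + 0 \<in> M"
      using g zero_mem by (intro M_I)
    moreover have "m = (a * i + (j - g)) + ((a + g) + 0)" using ij g by simp
    ultimately show "m \<in> sum_power M (Suc n)"
      by (metis set_plus_intro sum_power.simps(2))
  qed
qed

text \<open>From \<open>a * (a - 1)\<close> on, division by \<open>a\<close> has quotient at least
  \<open>a - 1\<close>, which bounds the remainder; so no exponent is missing.\<close>

lemma ideal_power_M:
  "ideal_power A (supported M) (a - 1) = (supported {a * (a - 1)..} :: 'k::field fps set)"
proof -
  have "sum_power M (a - 1) = {a * (a - 1)..}"
  proof (intro equalityI subsetI)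
    fix m assume "m \<in> sum_power M (a - 1)"
    then obtain i j where "m = a * i + j" "a - 1 \<le> i" by (auto simp: sum_power_M)
    then show "m \<in> {a * (a - 1)..}" by (simp add: trans_le_add1)
  next
    fix m assume m: "m \<in> {a * (a - 1)..}"
    have a: "0 < a" using l by simp
    then have "a - 1 \<le> m div a" using m by (simp add: less_eq_div_iff_mult_less_eq mult.commute)
    moreover have "m mod a < a" using a by simp
    ultimately have "m = a * (m div a) + m mod a \<and> m mod a \<le> m div a \<and> a - 1 \<le> m div a"
      by auto
    then show "m \<in> sum_power M (a - 1)" unfolding sum_power_M by blast
  qed
  then show ?thesis by (simp add: ideal_power_supported[OF M_closed])
qed

lemma colon_eq:
  "colon_ideal A (supported ({s} + H)) (supported {a * (a - 1)..}) = (supported E :: 'k::field fps set)"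
proof (intro equalityI subsetI)
  fix x :: "'k fps"
  assume x: "x \<in> colon_ideal A (supported ({s} + H)) (supported {a * (a - 1)..})"
  then have xH: "x \<in> supported H" by (simp add: colon_ideal_def)
  show "x \<in> supported E"
  proof (rule supportedI, rule ccontr)
    fix d assume d: "fps_nth x d \<noteq> 0" "d \<notin> E"
    then have "d < s" using supportedD[OF xH, of d] by (auto simp: E_def not_le)
    \<comment> \<open>This choice gives \<open>e + d = s + (a * (a - 1) - 1)\<close>, the Frobenius
      number shifted by \<open>s\<close>, and \<open>d < s\<close> keeps \<open>e\<close> beyond the
      conductor.\<close>
    define e where "e = a * (a - 1) + (s - 1 - d)"
    have "fps_X ^ e * x \<in> supported ({s} + H)"
      using x by (simp add: colon_ideal_def e_def)
    moreover have "fps_nth (fps_X ^ e * x) (e + d) \<noteq> 0"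
      using d by (simp add: fps_X_power_mult_nth)
    ultimately have "e + d \<in> {s} + H" using supportedD by blast
    then obtain h where "h \<in> H" "e + d = s + h" by (auto elim!: set_plus_elim)
    then have "h = a * (a - 1) - 1" using \<open>d < s\<close> s_less unfolding e_def by linarith
    with \<open>h \<in> H\<close> show False using frobenius_not_mem by simp
  qed
next
  fix x :: "'k fps" assume x: "x \<in> supported E"
  have "{a * (a - 1)..} + E \<subseteq> {s} + H"
  proof
    fix n assume "n \<in> {a * (a - 1)..} + E"
    then have "a * (a - 1) + s \<le> n" by (auto simp: E_def elim!: set_plus_elim)
    then have "n - s \<in> H" "n = s + (n - s)" by (auto intro: conductor)
    then show "n \<in> {s} + H" by (metis set_plus_intro singletonI)
  qed
  then have "y * x \<in> supported ({s} + H)" if "y \<in> supported {a * (a - 1)..}" for y :: "'k fps"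
    using supported_mult[OF that x] supported_mono by blast
  then show "x \<in> colon_ideal A (supported ({s} + H)) (supported {a * (a - 1)..})"
    using x supported_mono[OF E_sub] by (auto simp: colon_ideal_def)
qed

section \<open>Exponents of the powers of I\<close>

lemma E_low: "f \<le> \<kappa> \<Longrightarrow> s + f \<in> E"
  using H_I[of "r + f" l] r by (simp add: E_def s_def \<kappa>_def add.assoc)

lemma E_level: "v \<le> l + p \<Longrightarrow> 1 \<le> p \<Longrightarrow> a * (l + p) + v \<in> E"
proof -
  assume v: "v \<le> l + p" "1 \<le> p"
  have "s \<le> a * (l + 1)" using r l by (simp add: s_def)
  also have "\<dots> \<le> a * (l + p)" using v by (intro mult_le_mono2) simp
  finally show ?thesis using H_I[OF v(1)] by (simp add: E_def)
qed

text \<open>The block of \<open>H\<close> at level \<open>l\<close> ends at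
  \<open>a * l + l = s + \<kappa>\<close>, and the next one starts at
  \<open>a * (l + 1) = s + (a - r)\<close>.\<close>

lemma E_gap:
  assumes "n \<in> E"
  obtains f where "n = s + f" "f \<le> \<kappa> \<or> a - r \<le> f"
proof -
  obtain i j where ij: "n = a * i + j" "j \<le> i" using assms by (auto simp: E_def elim: H_E)
  have n: "s \<le> n" using assms by (simp add: E_def)
  have "l \<le> i"
  proof (rule ccontr)
    assume "\<not> l \<le> i"
    then have "a * (i + 1) \<le> a * l" "j < a" using ij l by (intro mult_le_mono2, auto)
    then show False using n ij by (simp add: s_def)
  qed
  then consider "i = l" | "l + 1 \<le> i" by linarith
  then have "n - s \<le> \<kappa> \<or> a - r \<le> n - s"
  proof cases
    case 1
    then show ?thesis using ij by (simp add: s_def \<kappa>_def diff_le_mono)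
  next
    case 2
    then have "a * (l + 1) \<le> a * i" by (rule mult_le_mono2)
    then have "a * l + a \<le> n" using ij by simp
    then show ?thesis unfolding s_def by linarith
  qed
  then show ?thesis using n that[of "n - s"] by simp
qed

text \<open>Offsets of at most \<open>\<kappa>\<close> add up to at most
  \<open>N * \<kappa>\<close>, while a single summand beyond the gap already carries the total
  beyond it.\<close>

lemma sum_power_gap:
  "n \<in> sum_power E N \<Longrightarrow> \<exists>f. n = N * s + f \<and> (f \<le> N * \<kappa> \<or> a - r \<le> f)"
proof (induction N arbitrary: n)
  case 0
  then obtain i j where ij: "n = a * i + j" "j \<le> i" by (auto elim: H_E)
  then have "n = 0 \<or> a \<le> n" by (cases i) auto
  then show ?case by auto
next
  case (Suc N)
  from Suc.prems obtain m e where me: "n = m + e" "m \<in> sum_power E N" "e \<in> E"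
    by (auto elim!: set_plus_elim)
  obtain f where f: "m = N * s + f" "f \<le> N * \<kappa> \<or> a - r \<le> f" using Suc.IH[OF me(2)] by blast
  obtain g where g: "e = s + g" "g \<le> \<kappa> \<or> a - r \<le> g" using E_gap[OF me(3)] .
  have "n = Suc N * s + (f + g)" "f + g \<le> Suc N * \<kappa> \<or> a - r \<le> f + g"
    using me(1) f g by auto
  then show ?case by blast
qed

lemma sum_power_1: "sum_power E (Suc 0) = E"
  using E_closed subset_plus[of E] by (auto simp: add.commute)

lemma sum_power_low: "f \<le> N * \<kappa> \<Longrightarrow> N * s + f \<in> sum_power E N"
proof (induction N arbitrary: f)
  case 0
  then show ?case by (simp add: zero_mem)
next
  case (Suc N)
  \<comment> \<open>The last summand absorbs as much of \<open>f\<close> as it can; at most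
    \<open>N * \<kappa>\<close> remains for the others.\<close>
  have "N * s + (f - min f \<kappa>) \<in> sum_power E N" using Suc.prems by (intro Suc.IH) auto
  moreover have "s + min f \<kappa> \<in> E" by (intro E_low) simp
  moreover have "Suc N * s + f = (N * s + (f - min f \<kappa>)) + (s + min f \<kappa>)" by simp
  ultimately show ?case by (metis set_plus_intro sum_power.simps(2))
qed

text \<open>Elements of \<open>E\<close> have the form \<open>a (l + p) + v\<close> with \<open>v \<le> l + p\<close>. If the remainder \<open>w\<close> is too large
  to be absorbed by the summands at the levels \<open>p\<close> and \<open>0\<close>, then \<open>a \<le> 2 l + 1\<close> forces a carry, and the
  levels \<open>p\<close> and \<open>1\<close> suffice.\<close>

lemma double_tail:
  assumes "a - r \<le> f"
  shows "2 * s + f \<in> E + E"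
proof -
  define p w where "p = (f + r) div a" and "w = (f + r) mod a"
  have a: "0 < a" using l by simp
  have fr: "f + r = a * p + w" by (simp add: p_def w_def)
  have w: "w < a" using a by (simp add: w_def)
  have p: "1 \<le> p" using assms a by (simp add: p_def less_eq_div_iff_mult_less_eq)
  have sum: "2 * s + f = a * (l + p) + a * l + r + w"
    using fr by (simp add: s_def algebra_simps)
  consider "w \<le> l + p" | "l + p < w" "w \<le> l + p + \<kappa>" | "l + p + \<kappa> < w" by linarith
  then show ?thesis
  proof cases
    case 1
    have "2 * s + f = (a * (l + p) + w) + (s + 0)" using sum by (simp add: s_def)
    then show ?thesis using E_level[OF 1 p] E_low[of 0] by (metis le0 set_plus_intro)
  next
    case 2
    have "2 * s + f = (a * (l + p) + (l + p)) + (s + (w - (l + p)))"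
      using sum 2 by (simp add: s_def)
    moreover have "s + (w - (l + p)) \<in> E" using 2 by (intro E_low) simp
    ultimately show ?thesis using E_level[OF order_refl p] by (metis set_plus_intro)
  next
    case 3
    \<comment> \<open>Indeed \<open>r + w > l + p + \<kappa> + r = 2 * l + p \<ge> a\<close>. Since
      \<open>w < a\<close>, less than \<open>r\<close> remains after the carry.\<close>
    have ge: "a \<le> r + w" using 3 p r a_le by (simp add: \<kappa>_def)
    have "2 * s + f = (a * (l + p) + (r + w - a)) + (a * (l + 1) + 0)"
      using sum ge by simp
    moreover have "a * (l + p) + (r + w - a) \<in> E" using w r p by (intro E_level) auto
    moreover have "a * (l + 1) + 0 \<in> E" by (intro E_level) auto
    ultimately show ?thesis by (metis set_plus_intro)
  qed
qed

lemma sum_power_tail: "2 \<le> N \<Longrightarrow> a - r \<le> f \<Longrightarrow> N * s + f \<in> sum_power E N"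
proof (induction N rule: dec_induct)
  case base
  then show ?case using double_tail[of f] sum_power_1 by (simp add: numeral_2_eq_2)
next
  case (step N)
  have "Suc N * s + f = (N * s + f) + (s + 0)" by simp
  then show ?case using step E_low[of 0] by (metis le0 set_plus_intro sum_power.simps(2))
qed

section \<open>Exponents in the gap\<close>

lemma kappa_pos: "0 < \<kappa>"
  using r by (simp add: \<kappa>_def)

lemma kappa_gap: "2 * \<kappa> + 1 < a - r"
  using a_ge r by (simp add: \<kappa>_def)

text \<open>Cancelling \<open>s\<close> would put \<open>2 * s + (2 * \<kappa> + 1)\<close> into
  \<open>sum_power E 2\<close>, although its offset lies strictly between
  \<open>2 * \<kappa>\<close> and \<open>a - r\<close>.\<close>

lemma witness_not_mem: "3 * s + (2 * \<kappa> + 1) \<notin> {s} + H + sum_power E 2"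
proof
  assume "3 * s + (2 * \<kappa> + 1) \<in> {s} + H + sum_power E 2"
  then obtain h m where hm: "h \<in> H" "m \<in> sum_power E 2" "3 * s + (2 * \<kappa> + 1) = s + h + m"
    by (auto elim!: set_plus_elim)
  then have "m + h \<in> sum_power E 2"
    using sum_power_closed(2)[OF E_sub E_closed E_nonempty, of 2] by blast
  from sum_power_gap[OF this] hm(3) kappa_gap show False by auto
qed

text \<open>The offset \<open>a - r - 1\<close> is missing from the \<open>N\<close>-th power and
  present in the next one. Dividing \<open>a - r - 2\<close> by \<open>\<kappa>\<close> accounts for
  the strict inequality.\<close>

lemma obtain_socle_degree:
  obtains N where "2 \<le> N" "N * \<kappa> < a - r - 1" "a - r - 1 \<le> Suc N * \<kappa>"
proof
  let ?N = "(a - r - 2) div \<kappa>"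
  show "2 \<le> ?N" using kappa_gap kappa_pos by (simp add: less_eq_div_iff_mult_less_eq)
  have "?N * \<kappa> \<le> a - r - 2" by simp
  then show "?N * \<kappa> < a - r - 1" using kappa_gap by linarith
  have "a - r - 2 < Suc ?N * \<kappa>"
    using kappa_pos by (metis dividend_less_div_times mult.commute mult_Suc)
  then show "a - r - 1 \<le> Suc ?N * \<kappa>" by linarith
qed

text \<open>For \<open>N = 2\<close> the exponent is beyond the conductor. For larger
  \<open>N\<close>, one \<open>s\<close> is counted as part of the offset, which then exceeds the
  gap because \<open>a \<le> s\<close>.\<close>

lemma socle_mem:
  assumes "2 \<le> N"
  shows "N * s + (a - r - 1) \<in> sum_power E (N - 1)"
proof (cases "N = 2")
  case True
  have "2 * s + (a - r - 1) \<in> E" using conductor two_s_ge by (simp add: E_def)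
  then show ?thesis using True sum_power_1 by simp
next
  case False
  then obtain M where M: "N = Suc M" "2 \<le> M" using assms by (cases N) auto
  have "M * s + (s + (a - r - 1)) \<in> sum_power E M"
    using M a_le_s by (intro sum_power_tail) auto
  then show ?thesis using M by (simp add: algebra_simps)
qed

text \<open>A positive offset of \<open>m\<close> pushes \<open>a - r - 1\<close> out of the gap.
  Offset zero forces \<open>n \<ge> 1\<close>, and then \<open>(N + n) * \<kappa>\<close> already
  reaches \<open>a - r - 1\<close>.\<close>

lemma socle_annihilates:
  assumes N: "2 \<le> N" "a - r - 1 \<le> Suc N * \<kappa>" and m: "m \<in> sum_power E n" "n = 0 \<Longrightarrow> m \<noteq> 0"
  shows "N * s + (a - r - 1) + m \<in> sum_power E (N + n)"
proof -
  obtain f where f: "m = n * s + f" using sum_power_gap[OF m(1)] by blast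
  have eq: "N * s + (a - r - 1) + m = (N + n) * s + (a - r - 1 + f)"
    by (simp add: f algebra_simps)
  show ?thesis
  proof (cases "f = 0")
    case True
    then have "Suc N * \<kappa> \<le> (N + n) * \<kappa>" using m f by (intro mult_le_mono1) (cases n, auto)
    then show ?thesis unfolding eq using True N by (intro sum_power_low) auto
  next
    case False
    then show ?thesis unfolding eq using N by (intro sum_power_tail) auto
  qed
qed

subsection \<open>The associated graded ring of \<open>I\<close>\<close>

sublocale S: cring_ideal "supported E :: 'k::field fps set" A
  by (intro cring_ideal.intro ideal_supported E_sub E_closed cring_A)

lemma power_E: "ideal_power A (supported E) n = (supported (sum_power E n) :: 'k::field fps set)"
  by (rule ideal_power_supported[OF E_sub E_closed E_nonempty])

lemma power_E_order: "(supported (sum_power E n) :: 'k::field fps set) \<subseteq> supported {n * s..}"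
  by (rule supported_mono) (use sum_power_gap in force)

text \<open>The initial form of \<open>t^s\<close> is a parameter of the associated graded ring: reading off the
  coefficient of \<open>t^(ns)\<close> in degree \<open>n\<close> maps that ring to \<open>k[[X]]\<close> and the initial form to \<open>X\<close>.\<close>

definition lowest :: "(nat \<Rightarrow> 'k::field fps set) \<Rightarrow> 'k fps" where
  "lowest g = Abs_fps (\<lambda>n. fps_nth (SOME y. y \<in> g n) (n * s))"

text \<open>Representatives differ by an element of the next power, whose order is at least
  \<open>Suc n * s > n * s\<close>. So the choice made by \<open>SOME\<close> does not affect the
  coefficient.\<close>

lemma lowest_nth:
  fixes x :: "'k::field fps"
  assumes x: "x \<in> S.pw n" and g: "g n = S.pw (Suc n) +>\<^bsub>A\<^esub> x"
  shows "fps_nth (lowest g) n = fps_nth x (n * s)"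
proof -
  have "x \<in> g n" unfolding g by (rule S.pw_coset_self[OF S.pw_carrier[OF x]])
  then have "(SOME y. y \<in> g n) \<in> g n" by (rule someI)
  then obtain u where u: "u \<in> S.pw (Suc n)" "(SOME y. y \<in> g n) = u + x"
    by (auto simp: g a_r_coset_def')
  have "u \<in> supported {Suc n * s..}"
    using u(1) power_E_order unfolding power_E by blast
  moreover have "n * s \<notin> {Suc n * s..}" using a_le_s l by simp
  ultimately have "fps_nth u (n * s) = 0" by (rule supportedD)
  then show ?thesis using u by (simp add: lowest_def)
qed

lemma lowest_init_form:
  fixes x :: "'k::field fps"
  assumes "x \<in> S.pw j"
  shows "fps_nth (lowest (S.init_form j x)) n = (if n = j then fps_nth x (j * s) else 0)"
proof -
  have "fps_nth (lowest (S.init_form j x)) n = fps_nth (if n = j then x else 0) (n * s)"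
    using assms S.pw_zero[of n] by (intro lowest_nth) (auto simp: S.init_form_def)
  then show ?thesis by simp
qed

text \<open>The representatives \<open>x i\<close> and \<open>y (n - i)\<close> have orders at least
  \<open>i * s\<close> and \<open>(n - i) * s\<close>, so the coefficient of their product at
  \<open>n * s\<close> is the product of these lowest coefficients.\<close>

lemma lowest_mult:
  fixes g h :: "nat \<Rightarrow> 'k::field fps set"
  assumes "g \<in> carrier S.G" "h \<in> carrier S.G"
  shows "lowest (g \<otimes>\<^bsub>S.G\<^esub> h) = lowest g * lowest h"
proof (rule fps_ext)
  fix n
  obtain x where x: "\<And>n. x n \<in> S.pw n" "\<And>n. g n = S.pw (Suc n) +>\<^bsub>A\<^esub> x n"
    using S.G_carrier_reps[OF assms(1)] by blast
  obtain y where y: "\<And>n. y n \<in> S.pw n" "\<And>n. h n = S.pw (Suc n) +>\<^bsub>A\<^esub> y n"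
    using S.G_carrier_reps[OF assms(2)] by blast
  let ?w = "finsum A (\<lambda>i. x i \<otimes>\<^bsub>A\<^esub> y (n - i)) {..n}"
  have xy: "x i \<otimes>\<^bsub>A\<^esub> y (n - i) \<in> S.pw n" if "i \<le> n" for i
    using S.pw_mult[OF x(1)[of i] y(1)[of "n - i"]] that by simp
  have w: "?w = (\<Sum>i\<le>n. x i * y (n - i))"
    using S.pw_carrier[OF xy] by (subst finsum_A) auto
  have "fps_nth (lowest (g \<otimes>\<^bsub>S.G\<^esub> h)) n = fps_nth ?w (n * s)"
  proof (rule lowest_nth)
    show "?w \<in> S.pw n" by (rule S.pw_finsum) (simp_all only: atMost_iff finite_atMost xy)
    show "(g \<otimes>\<^bsub>S.G\<^esub> h) n = S.pw (Suc n) +>\<^bsub>A\<^esub> ?w"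
      by (rule S.G_mult_eq[OF x y])
  qed
  also have "\<dots> = (\<Sum>i\<le>n. fps_nth (x i * y (n - i)) (n * s))"
    by (simp only: w fps_sum_nth)
  also have "\<dots> = (\<Sum>i\<le>n. fps_nth (lowest g) i * fps_nth (lowest h) (n - i))"
  proof (rule sum.cong)
    fix i assume "i \<in> {..n}"
    then have n: "n * s = i * s + (n - i) * s" by (simp flip: add_mult_distrib)
    have "x i \<in> supported {i * s..}" "y (n - i) \<in> supported {(n - i) * s..}"
      using x(1)[of i] y(1)[of "n - i"] power_E_order unfolding power_E by blast+
    then show "fps_nth (x i * y (n - i)) (n * s) = fps_nth (lowest g) i * fps_nth (lowest h) (n - i)"
      unfolding n lowest_nth[of "x i" i g, OF x] lowest_nth[of "y (n - i)" "n - i" h, OF y]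
      by (rule fps_mult_nth_lowest)
  qed simp
  finally show "fps_nth (lowest (g \<otimes>\<^bsub>S.G\<^esub> h)) n = fps_nth (lowest g * lowest h) n"
    by (simp add: fps_mult_nth atLeast0AtMost)
qed

lemma lowest_add:
  fixes g h :: "nat \<Rightarrow> 'k::field fps set"
  assumes "g \<in> carrier S.G" "h \<in> carrier S.G"
  shows "lowest (g \<oplus>\<^bsub>S.G\<^esub> h) = lowest g + lowest h"
proof (rule fps_ext)
  fix n
  obtain x where x: "\<And>n. x n \<in> S.pw n" "\<And>n. g n = S.pw (Suc n) +>\<^bsub>A\<^esub> x n"
    using S.G_carrier_reps[OF assms(1)] by blast
  obtain y where y: "\<And>n. y n \<in> S.pw n" "\<And>n. h n = S.pw (Suc n) +>\<^bsub>A\<^esub> y n"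
    using S.G_carrier_reps[OF assms(2)] by blast
  have "x n \<oplus>\<^bsub>A\<^esub> y n \<in> S.pw n"
    by (rule additive_subgroup.a_closed[OF ideal.axioms(1)[OF S.ideal_pw] x(1) y(1)])
  then have "fps_nth (lowest (g \<oplus>\<^bsub>S.G\<^esub> h)) n = fps_nth (x n \<oplus>\<^bsub>A\<^esub> y n) (n * s)"
    by (rule lowest_nth) (rule S.G_add_eq[of "x n" n g "y n" h, OF x y])
  then show "fps_nth (lowest (g \<oplus>\<^bsub>S.G\<^esub> h)) n = fps_nth (lowest g + lowest h) n"
    by (simp add: lowest_nth[of "x n" n g, OF x] lowest_nth[of "y n" n h, OF y])
qed

lemma lowest_hom:
  "lowest \<in> ring_hom (S.G :: (nat \<Rightarrow> 'k::field fps set) ring) ring_of_type_algebra"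
proof (rule ring_hom_memI)
  have "\<one>\<^bsub>A\<^esub> \<in> (S.pw 0 :: 'k fps set)"
    using fps_const_supported[OF zero_mem, of "1 :: 'k"] unfolding power_E by simp
  from lowest_init_form[OF this]
  show "lowest \<one>\<^bsub>S.G :: (nat \<Rightarrow> 'k fps set) ring\<^esub> = \<one>\<^bsub>ring_of_type_algebra\<^esub>"
    by (auto simp: S.one_eq_init_form intro!: fps_ext)
qed (simp_all add: lowest_mult lowest_add)

lemma not_cohen_macaulay: "\<not> cohen_macaulay_ring (S.G :: (nat \<Rightarrow> 'k::field fps set) ring)"
proof
  let ?G = "S.G :: (nat \<Rightarrow> 'k fps set) ring"
  assume CM: "cohen_macaulay_ring ?G"
  \<comment> \<open>The assumption to be refuted supplies the ring axioms of \<open>G\<close>, which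
    the criterion presupposes.\<close>
  then interpret G: cring ?G by (simp add: cohen_macaulay_ring_def)
  obtain N where N: "2 \<le> N" "N * \<kappa> < a - r - 1" "a - r - 1 \<le> Suc N * \<kappa>"
    by (rule obtain_socle_degree)
  define e where "e = N * s + (a - r - 1)"
  define z where "z = (fps_X ^ e :: 'k fps)"
  have Suc_N: "Suc (N - 1) = N" using N by simp
  have z_mem: "z \<in> S.pw (N - 1)"
    using socle_mem[OF N(1)] by (simp add: z_def e_def power_E)
  have "e \<notin> sum_power E N"
  proof
    assume "e \<in> sum_power E N"
    from sum_power_gap[OF this] show False using N kappa_gap by (auto simp: e_def)
  qed
  then have "z \<notin> S.pw (Suc (N - 1))"
    by (simp only: Suc_N power_E z_def X_power_supported_iff not_False_eq_True)
  then have z_ne: "S.init_form (N - 1) z \<noteq> \<zero>\<^bsub>?G\<^esub>"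
    using S.init_form_eq_zero_iff[OF z_mem] by simp
  have t_mem: "(fps_X ^ s :: 'k fps) \<in> S.pw 1"
    using s_mem unfolding power_E One_nat_def sum_power_1 by (simp add: E_def)
  have const_mem: "(fps_const c :: 'k fps) \<in> S.pw 0" for c
    using fps_const_supported[OF zero_mem] unfolding power_E by simp
  have "\<not> cohen_macaulay_ring ?G"
  proof (rule G.not_cohen_macaulay_if_socle)
    show "lowest \<in> ring_hom ?G ring_of_type_algebra" by (rule lowest_hom)
    show "\<exists>g\<in>carrier ?G. lowest g = fps_const c" for c
      using S.init_form_closed[OF const_mem] lowest_init_form[OF const_mem]
      by (intro bexI[of _ "S.init_form 0 (fps_const c)"]) (auto intro!: fps_ext)
    show "S.init_form 1 (fps_X ^ s) \<in> carrier ?G" by (rule S.init_form_closed[OF t_mem])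
    show "lowest (S.init_form 1 (fps_X ^ s :: 'k fps)) \<noteq> 0"
      using lowest_init_form[OF t_mem, of 1] by (metis fps_zero_nth mult_1 fps_X_power_nth zero_neq_one)
    show "fps_nth (lowest (S.init_form 1 (fps_X ^ s :: 'k fps))) 0 = 0"
      using lowest_init_form[OF t_mem, of 0] by simp
    show "S.init_form (N - 1) z \<in> carrier ?G" by (rule S.init_form_closed[OF z_mem])
    show "S.init_form (N - 1) z \<noteq> \<zero>\<^bsub>?G\<^esub>" by (rule z_ne)
    fix g assume g: "g \<in> carrier ?G" "fps_nth (lowest g) 0 = 0"
    obtain y where y: "\<And>n. y n \<in> S.pw n" "\<And>n. g n = S.pw (Suc n) +>\<^bsub>A\<^esub> y n"
      using S.G_carrier_reps[OF g(1)] by blast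
    have y0: "fps_nth (y 0) 0 = 0" using g(2) lowest_nth[of "y 0" 0 g, OF y] by simp
    have "z \<otimes>\<^bsub>A\<^esub> y n \<in> S.pw (Suc (N - 1 + n))" for n
    proof -
      \<comment> \<open>Excluding \<open>0\<close> in degree zero expresses that \<open>y 0\<close>
        has no constant term. As \<open>z\<close> sits in degree \<open>N - 1\<close>, its product
        with degree \<open>n\<close> vanishes once it lies in the power
        \<open>N + n\<close>.\<close>
      let ?S = "{m \<in> sum_power E n. n = 0 \<longrightarrow> m \<noteq> 0}"
      have "y n \<in> supported (sum_power E n)"
        using y(1)[of n] unfolding power_E .
      then have "y n \<in> supported ?S"
        using y0 unfolding supported_def by (auto intro!: gr0I)
      then have "z * y n \<in> supported ({e} + ?S)"
        unfolding z_def by (intro supported_mult) simp_all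
      moreover have "{e} + ?S \<subseteq> sum_power E (N + n)"
      proof
        fix m assume "m \<in> {e} + ?S"
        then obtain m' where "m = e + m'" "m' \<in> ?S" by (auto elim: set_plus_elim)
        then show "m \<in> sum_power E (N + n)"
          using socle_annihilates[OF N(1,3), of m' n] by (simp add: e_def)
      qed
      moreover have "Suc (N - 1 + n) = N + n" using N by simp
      ultimately show ?thesis
        using supported_mono unfolding power_E
        by (metis (no_types) semigroup_ring_simps(2) subsetD)
    qed
    then show "g \<otimes>\<^bsub>?G\<^esub> S.init_form (N - 1) z = \<zero>\<^bsub>?G\<^esub>"
      by (intro S.init_form_annihilates[OF z_mem y])
  qed
  then show False using CM by simp
qed

section \<open>The intersection of Q with the cube of I\<close>

lemma witness:
  "supported ({s} + H) \<inter> ideal_power A (supported E) 3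
    \<noteq> ideal_prod A (supported ({s} + H)) (ideal_power A (supported E :: 'k::field fps set) 2)"
proof -
  let ?x = "fps_X ^ (3 * s + (2 * \<kappa> + 1)) :: 'k fps"
  have sH: "{s} + H \<subseteq> H" "{s} + H + H \<subseteq> {s} + H" "{s} + H \<noteq> {}"
  proof -
    have "{s} \<subseteq> H" using s_mem by blast
    from set_plus_mono2[OF this subset_refl, of H] show "{s} + H \<subseteq> H" unfolding add_self .
    show "{s} + H + H \<subseteq> {s} + H" by (simp only: add.assoc add_self order_refl)
    show "{s} + H \<noteq> {}" using set_plus_intro[of s "{s}" 0 H] zero_mem by blast
  qed
  \<comment> \<open>The cofactor of \<open>fps_X ^ s\<close> lies beyond the conductor, hence in
    \<open>A\<close>.\<close>
  have "2 * s + (2 * \<kappa> + 1) \<in> H" using two_s_ge by (intro conductor) simp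
  then have "s + (2 * s + (2 * \<kappa> + 1)) \<in> {s} + H" by (rule set_plus_intro[OF singletonI])
  moreover have "3 * s + (2 * \<kappa> + 1) = s + (2 * s + (2 * \<kappa> + 1))" by simp
  ultimately have "3 * s + (2 * \<kappa> + 1) \<in> {s} + H" by (simp only:)
  \<comment> \<open>As \<open>\<kappa> \<ge> 1\<close>, the offset is at most
    \<open>3 * \<kappa>\<close>.\<close>
  moreover have "3 * s + (2 * \<kappa> + 1) \<in> sum_power E 3"
    using kappa_pos by (intro sum_power_low) simp
  ultimately have "?x \<in> supported ({s} + H) \<inter> ideal_power A (supported E) 3"
    by (simp only: power_E X_power_supported_iff Int_iff)
  moreover have "?x \<notin> ideal_prod A (supported ({s} + H)) (ideal_power A (supported E) 2)"
    using witness_not_mem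
    by (simp only: power_E ideal_prod_supported[OF sH sum_power_closed[OF E_sub E_closed E_nonempty]]
        X_power_supported_iff not_False_eq_True)
  ultimately show ?thesis by blast
qed

end

theorem theorem3p9:
  fixes a q s l r \<kappa> :: nat
    and H :: "nat set"
    and A :: "'k::field fps ring"
    and \<mm> Q I :: "'k fps set"
  assumes "a \<ge> 2"
    and "H = consecutive_semigroup a"
    and "A = semigroup_ring H"
    and "\<mm> = Idl\<^bsub>A\<^esub> {fps_X ^ a, fps_X ^ (a + 1)}"
    and "q = a - 1"
    and "s \<in> H" and "0 < s" and "s < a * q"
    and "Q = Idl\<^bsub>A\<^esub> {fps_X ^ s}"
    and "I = colon_ideal A Q (ideal_power A \<mm> q)"
    and "s = a * l + r"
    and "1 \<le> l" and "l < q" and "r < a"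
    and "0 < r" and "r < l"
    and "\<kappa> = l - r"
    and "2 * l + 1 \<ge> a" and "a \<ge> l + \<kappa> + 2"
  shows "Q \<inter> ideal_power A I 3 \<noteq> ideal_prod A Q (ideal_power A I 2)
       \<and> \<not> cohen_macaulay_ring (assoc_graded A I)"
proof -
  interpret T: two_generated a l r
    using assms by unfold_locales auto
  have H: "H = T.H" and s: "s = T.s"
    using assms(2,11) by (simp_all add: T.H_def T.s_def)
  have A: "A = semigroup_ring T.H" using assms(3) H by simp
  have Q: "Q = supported ({T.s} + T.H)"
    using assms(9) T.genideal_s unfolding A s by simp
  have I: "I = supported T.E"
    using T.colon_eq unfolding assms(4,5,10) A Q T.genideal_maximal T.ideal_power_M .
  show ?thesis
    unfolding A Q I using T.witness T.not_cohen_macaulay by blast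
qed

end
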